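(* Let $A\subset \mathbb{R}^p$ be a compact set with $\mathcal{H}_d(A)>0$, where $0<d\leqslant p$, and let $s>d$. Then there exists a constant $c>0$ such that for any sequence $\omega^*_\infty=\{a^*_j\}_{j=1}^\infty$ of greedy $s$-energy points on $A$ and any $i<j$, $$|a^*_i-a^*_j|\geqslant c\,j^{-1/d}.$$ If, in addition, $A\subset \tilde{A}$ for a $d$-regular compact set $\tilde{A}\subset\mathbb{R}^p$ and $\overline{\mathcal{M}}_d(A)<\infty$, then for some constant $c>0$, for any such sequence and every $N\geqslant 2$, the covering radius of $\omega^*_N:=\{a^*_1, \ldots, a^*_N\}$ satisfies $$\eta(\omega^*_N, A):=\max_{y\in A}\min_{j=1,\ldots, N} |y-a_j^*|\leqslant c\,N^{-1/d}.$$
   Context: $\mathcal{H}_d$ is the $d$-dimensional Hausdorff measure normalized by $\mathcal{H}_d([0,1]^d)=1$. The upper $d$-dimensional Minkowski content of a compact set $A\subset\mathbb{R}^p$ is $$\overline{\mathcal{M}}_d(A):=\limsup_{\varepsilon\to 0^+} \frac{\mathcal{L}_p\left( \{x\in \mathbb{R}^p: \mathrm{dist}(x, A)<\varepsilon\}\right)}{\beta_{p-d}\,\varepsilon^{p-d}},$$ where $\mathcal{L}_p$ is Lebesgue measure on $\mathbb{R}^p$ and $\beta_{p-d}$ is the volume of a $(p-d)$-dimensional unit ball ($\beta_0:=1$). A compact set $\tilde A$ is $d$-regular if for some finite Borel measure $\lambda$ supported on $\tilde A$ there is a positive constant $C_0$ such that $C_0^{-1}r^d\leqslant \lambda(B(x,r))\leqslant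 C_0r^d$ for all $x\in \tilde A$ and $0<r<\mathrm{diam}(\tilde A)$, where $B(x,r)$ is the open ball. A sequence $\{a^*_j\}_{j=1}^\infty\subset A$ is called a sequence of greedy $s$-energy points if $a^*_1\in A$ and for every $N>1$ $$\sum_{j=1}^{N-1}\frac{1}{|a^*_N-a^*_j|^s} = \inf_{y\in A}\sum_{j=1}^{N-1}\frac{1}{|y-a^*_j|^s},$$ with the convention $1/0^s=+\infty$. *)

theory Defs
  imports "HOL-Analysis.Analysis"
begin

text \<open>
  The factor \<open>unit_ball_vol d * (diam / 2) powr d\<close> is the volume of a \<open>d\<close>-dimensional ball of the
  given diameter; for integer \<open>d\<close> it is the constant for which (by the isodiametric inequality)
  the \<open>d\<close>-dimensional unit cube has measure 1, and for the other real \<open>d\<close> it is the usual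
  interpolation of that constant.  The covering sets are required to be bounded because
  \<^const>\<open>diameter\<close> is meaningless on unbounded sets.  These functions are intended for \<open>d > 0\<close>.
\<close>

definition hausdorff_premeasure :: "real \<Rightarrow> real \<Rightarrow> 'a::metric_space set \<Rightarrow> ennreal" where
  "hausdorff_premeasure d \<delta> A =
     (INF U \<in> {U :: nat \<Rightarrow> 'a set.
                 A \<subseteq> (\<Union>i. U i) \<and> (\<forall>i. bounded (U i) \<and> diameter (U i) \<le> \<delta>)}.
        \<Sum>i. ennreal (unit_ball_vol d * (diameter (U i) / 2) powr d))"

definition hausdorff_measure :: "real \<Rightarrow> 'a::metric_space set \<Rightarrow> ennreal" where
  "hausdorff_measure d A = (SUP \<delta> \<in> {0<..}. hausdorff_premeasure d \<delta> A)"

text \<open>Intended for nonempty \<open>A\<close>, since \<^term>\<open>infdist x {} = 0\<close>.\<close>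

definition upper_minkowski_content :: "real \<Rightarrow> 'a::euclidean_space set \<Rightarrow> ennreal" where
  "upper_minkowski_content d A =
     Limsup (at_right 0) (\<lambda>\<epsilon>::real.
       emeasure lborel {x. infdist x A < \<epsilon>} /
       ennreal (unit_ball_vol (real DIM('a) - d) * \<epsilon> powr (real DIM('a) - d)))"

definition d_regular :: "real \<Rightarrow> 'a::euclidean_space set \<Rightarrow> bool" where
  "d_regular d S \<longleftrightarrow> compact S \<and>
     (\<exists>\<mu> :: 'a measure. finite_measure \<mu> \<and> sets \<mu> = sets borel \<and> emeasure \<mu> (- S) = 0 \<and>
       (\<exists>C>0. \<forall>x\<in>S. \<forall>r. 0 < r \<and> r < diameter S \<longrightarrow>
          inverse C * r powr d \<le> measure \<mu> (ball x r) \<and>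
          measure \<mu> (ball x r) \<le> C * r powr d))"

text \<open>
  For \<open>s > 0\<close> the value at \<open>x = y\<close> is \<open>1 / 0 = \<infinity>\<close>, because division in \<^typ>\<open>ennreal\<close> satisfies
  \<^prop>\<open>1 / (0::ennreal) = \<infinity>\<close>.
\<close>

definition riesz_kernel :: "real \<Rightarrow> 'a::real_normed_vector \<Rightarrow> 'a \<Rightarrow> ennreal" where
  "riesz_kernel s x y = 1 / ennreal (norm (x - y) powr s)"

lemma riesz_kernel_diag: "riesz_kernel s x x = \<infinity>"
  by (simp add: riesz_kernel_def divide_ennreal_def)

lemma riesz_kernel_off_diag:
  "x \<noteq> y \<Longrightarrow> riesz_kernel s x y = ennreal (1 / norm (x - y) powr s)"
  by (simp add: riesz_kernel_def divide_ennreal flip: ennreal_1)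

text \<open>Sequences are indexed from 1; the value \<open>a 0\<close> is irrelevant.\<close>

definition greedy_energy_sequence ::
  "real \<Rightarrow> 'a::real_normed_vector set \<Rightarrow> (nat \<Rightarrow> 'a) \<Rightarrow> bool" where
  "greedy_energy_sequence s A a \<longleftrightarrow>
     (\<forall>j\<ge>1. a j \<in> A) \<and>
     (\<forall>N>1. (\<Sum>j=1..N-1. riesz_kernel s (a N) (a j)) =
             (INF y\<in>A. \<Sum>j=1..N-1. riesz_kernel s y (a j)))"

text \<open>
  Intended for finite nonempty \<open>X\<close> and compact nonempty \<open>A\<close>; then the supremum is a maximum.
\<close>

definition covering_radius :: "'a::real_normed_vector set \<Rightarrow> 'a set \<Rightarrow> real" where
  "covering_radius X A = (SUP y\<in>A. MIN x\<in>X. norm (y - x))"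

lemma covering_radius_attained:
  fixes A :: "'a::real_normed_vector set"
  assumes "compact A" "A \<noteq> {}" "finite X" "X \<noteq> {}"
  obtains y where "y \<in> A" "covering_radius X A = (MIN x\<in>X. norm (y - x))"
    "\<And>z. z \<in> A \<Longrightarrow> (MIN x\<in>X. norm (z - x)) \<le> (MIN x\<in>X. norm (y - x))"
proof -
  have eq: "(MIN x\<in>X. norm (y - x)) = infdist y X" for y
    using assms(3,4) by (simp add: infdist_def dist_norm cInf_eq_Min)
  have "continuous_on A (\<lambda>y. infdist y X)"
    by (intro continuous_intros)
  from continuous_attains_sup[OF assms(1,2) this]
  obtain y where y: "y \<in> A" "\<forall>z\<in>A. infdist z X \<le> infdist y X"
    by blast
  then have "(SUP z\<in>A. infdist z X) = infdist y X"
    by (intro cSup_eq_maximum) auto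
  then show thesis
    using that[of y] y by (simp add: covering_radius_def eq)
qed

end

theory Submission
  imports Defs
begin

text \<open>
  By Vitali's covering lemma and positivity of the Hausdorff content of \<open>A\<close>, for any \<open>N\<close> points
  \<open>x\<^sub>j\<close> some \<open>y \<in> A\<close> has at most \<open>K N r\<^sup>d\<close> of them within distance \<open>r\<close>, for every \<open>r > 0\<close>.
  Ordering the points by distance from \<open>y\<close>, the \<open>k\<close>-th distance is at least \<open>(k / (K N))\<^bsup>1/d\<^esup>\<close>, so
  the potential at \<open>y\<close> is at most \<open>\<zeta>(s/d) (K N)\<^bsup>s/d\<^esup>\<close>.  A greedy point does no worse, and this
  separates it from its predecessors.

  For the covering radius \<open>\<eta>\<close>, attained at \<open>y\<close>, two estimates of the potential at \<open>y\<close> are compared.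
  From below: a volume argument forces some greedy point with index at most \<open>N\<close> to lie within
  \<open>O(N\<^bsup>-1/d\<^esup>)\<close> of an earlier one, hence its potential, which bounds all later minima from below,
  is at least a multiple of \<open>N\<^bsup>s/d\<^esup>\<close>.  From above: separation and \<open>d\<close>-regularity bound the number of
  greedy points within \<open>r\<close> of \<open>y\<close> by \<open>L N r\<^sup>d\<close>; with an auxiliary exponent \<open>d < s' < s\<close> the potential is
  at most \<open>\<eta>\<^bsup>s'-s\<^esup>\<close> times a sum over the exponent \<open>s'\<close>, which is \<open>O(N\<^bsup>s'/d\<^esup>)\<close>.
\<close>

section \<open>Sums of negative powers under a counting bound\<close>

text \<open>The k-th smallest value t satisfies k \<le> L t^d, so its term is at most (L/k)^(s/d).
  The induction removes an index with the largest value, whose rank is \<open>card J\<close>; the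
  counting bound survives because removal only lowers counts.\<close>

lemma sum_powr_le_of_counting:
  fixes f :: "'i \<Rightarrow> real"
  assumes "finite J" and d: "0 < d" and s: "0 < s"
    and "\<And>j. j \<in> J \<Longrightarrow> 0 < f j"
    and "\<And>r. 0 < r \<Longrightarrow> real (card {j\<in>J. f j \<le> r}) \<le> L * r powr d"
  shows "(\<Sum>j\<in>J. f j powr (- s)) \<le> L powr (s / d) * (\<Sum>k\<in>{1..card J}. real k powr (- (s / d)))"
  using assms(1,4,5)
proof (induction "card J" arbitrary: J)
  case 0
  then show ?case by simp
next
  case (Suc n)
  have J: "finite J" "J \<noteq> {}" using Suc by auto
  have "f ` J \<noteq> {}" "finite (f ` J)" using J by auto
  then have "Max (f ` J) \<in> f ` J" using Max_in by blast
  then obtain m where m: "m \<in> J" "f m = Max (f ` J)" by auto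
  have mx: "f j \<le> f m" if "j \<in> J" for j using that m J by simp
  have pos: "0 < f m" using Suc(4) m(1) by blast
  have eq: "{j\<in>J. f j \<le> f m} = J" using mx by auto
  have c: "real (Suc n) \<le> L * f m powr d" using Suc(5)[OF pos] eq Suc(2) by simp
  then have "0 < L * f m powr d" by linarith
  then have L: "0 < L" using pos by (simp add: zero_less_mult_iff)
  have 1: "f m powr (- s) \<le> L powr (s / d) * real (Suc n) powr (- (s / d))"
  proof -
    have "(L * f m powr d) powr (- (s / d)) \<le> real (Suc n) powr (- (s / d))"
      using c d s by (intro powr_mono2') auto
    also have "(L * f m powr d) powr (- (s / d)) = L powr (- (s / d)) * f m powr (- s)"
      using L pos d by (simp add: powr_mult powr_powr)
    finally have "L powr (- (s / d)) * f m powr (- s) \<le> real (Suc n) powr (- (s / d))" .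
    then have "L powr (s / d) * (L powr (- (s / d)) * f m powr (- s)) \<le> L powr (s / d) * real (Suc n) powr (- (s / d))"
      by (intro mult_left_mono) auto
    moreover have "L powr (s / d) * (L powr (- (s / d)) * f m powr (- s)) = f m powr (- s)"
      using L by (simp flip: powr_add mult.assoc)
    ultimately show ?thesis by simp
  qed
  have cJ: "n = card (J - {m})" using Suc m J by simp
  have 2: "(\<Sum>j\<in>J - {m}. f j powr (- s)) \<le> L powr (s / d) * (\<Sum>k\<in>{1..card (J - {m})}. real k powr (- (s / d)))"
  proof (rule Suc(1)[OF cJ])
    fix r :: real assume r: "0 < r"
    have "card {j \<in> J - {m}. f j \<le> r} \<le> card {j \<in> J. f j \<le> r}"
      using J by (intro card_mono) auto
    then show "real (card {j \<in> J - {m}. f j \<le> r}) \<le> L * r powr d" using Suc(5)[OF r] by linarith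
  qed (use J Suc in auto)
  have "(\<Sum>j\<in>J. f j powr (- s)) = f m powr (- s) + (\<Sum>j\<in>J - {m}. f j powr (- s))"
    using J m by (simp add: sum.remove)
  also have "\<dots> \<le> L powr (s / d) * (\<Sum>k\<in>{1..Suc n}. real k powr (- (s / d)))"
    using 1 2 cJ by (simp add: algebra_simps)
  finally show ?case using Suc(2) by simp
qed

text \<open>The exponent s/d > 1 makes the series converge. Its term k = 0 vanishes because
  \<open>0 powr x = 0\<close>, so the constant is zeta(s/d), independent of
  \<open>J\<close>.\<close>

lemma sum_powr_le_of_counting_suminf:
  fixes f :: "'i \<Rightarrow> real"
  assumes "finite J" and d: "0 < d" and s: "d < s"
    and "\<And>j. j \<in> J \<Longrightarrow> 0 < f j"
    and "\<And>r. 0 < r \<Longrightarrow> real (card {j\<in>J. f j \<le> r}) \<le> L * r powr d"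
  shows "(\<Sum>j\<in>J. f j powr (- s)) \<le> L powr (s / d) * (\<Sum>k. real k powr (- (s / d)))"
proof -
  have "summable (\<lambda>k. real k powr (- (s / d)))"
    using d s by (subst summable_real_powr_iff) (simp add: field_simps)
  then have "(\<Sum>k\<in>{1..card J}. real k powr (- (s / d))) \<le> (\<Sum>k. real k powr (- (s / d)))"
    by (intro sum_le_suminf) auto
  moreover have "(\<Sum>j\<in>J. f j powr (- s)) \<le> L powr (s / d) * (\<Sum>k\<in>{1..card J}. real k powr (- (s / d)))"
    using assms by (intro sum_powr_le_of_counting) auto
  ultimately show ?thesis
    by (meson mult_left_mono order_trans powr_ge_zero)
qed

lemma suminf_powr_pos:
  assumes "0 < d" "d < (s::real)"
  shows "0 < (\<Sum>k. real k powr (- (s / d)))"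
proof -
  have "summable (\<lambda>k. real k powr (- (s / d)))"
    using assms by (subst summable_real_powr_iff) (simp add: field_simps)
  then show ?thesis by (intro suminf_pos2[where i=1]) auto
qed

section \<open>Hausdorff content and points with few neighbours\<close>

text \<open>A single scale \<delta> with positive premeasure suffices. Balls of radius at most
  \<delta>/2 form an admissible cover, while one larger ball alone contributes (\<delta>/2)^d;
  \<open>\<kappa>\<close> is the minimum of the two resulting bounds.\<close>

lemma hausdorff_measure_pos_imp_cover:
  fixes A :: "'a::euclidean_space set"
  assumes d: "0 < d" and "hausdorff_measure d A > 0"
  obtains \<kappa> where "0 < \<kappa>"
    "\<And>(F::'a set) r. \<lbrakk>finite F; \<And>x. x \<in> F \<Longrightarrow> 0 \<le> r x; A \<subseteq> (\<Union>x\<in>F. cball x (r x))\<rbrakk>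
        \<Longrightarrow> \<kappa> \<le> (\<Sum>x\<in>F. r x powr d)"
proof -
  obtain \<delta> where \<delta>: "\<delta> > 0" "hausdorff_premeasure d \<delta> A > 0"
    using assms(2) by (auto simp: hausdorff_measure_def less_SUP_iff)
  \<comment> \<open>A finite number below the premeasure is taken, as the premeasure of a general
    \<open>A\<close> can be infinite.\<close>
  obtain m where m: "m > 0" "ennreal m < hausdorff_premeasure d \<delta> A"
  proof -
    obtain z where z: "0 < z" "z < hausdorff_premeasure d \<delta> A" using dense[OF \<delta>(2)] by blast
    then have "z < \<infinity>" using order.strict_trans2[OF z(2)] by (simp add: less_top)
    then show thesis using that[of "enn2real z"] z by (simp add: enn2real_positive_iff less_top)
  qed
  define v where "v = unit_ball_vol d"
  have v: "v > 0" using d by (simp add: v_def)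
  define \<kappa> where "\<kappa> = min (m / v) ((\<delta> / 2) powr d)"
  show thesis
  proof (rule that)
    show "0 < \<kappa>" using m v \<delta> by (simp add: \<kappa>_def)
    fix F :: "'a set" and r
    assume F: "finite F" and r: "\<And>x. x \<in> F \<Longrightarrow> 0 \<le> r x"
      and cov: "A \<subseteq> (\<Union>x\<in>F. cball x (r x))"
    show "\<kappa> \<le> (\<Sum>x\<in>F. r x powr d)"
    proof (cases "\<forall>x\<in>F. r x \<le> \<delta> / 2")
      case False
      then obtain x where x: "x \<in> F" "\<delta> / 2 < r x" by force
      have "\<kappa> \<le> (\<delta> / 2) powr d" by (simp add: \<kappa>_def)
      also have "\<dots> \<le> r x powr d" using x \<delta> d by (intro powr_mono2) auto
      also have "\<dots> \<le> (\<Sum>x\<in>F. r x powr d)" using x F by (intro member_le_sum) auto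
      finally show ?thesis .
    next
      case True
      obtain h where h: "bij_betw h {..<card F} F"
        using ex_bij_betw_nat_finite[OF F] by (auto simp: atLeast0LessThan)
      \<comment> \<open>The finite family is padded by empty sets; these add nothing, since
        \<open>diameter {} = 0\<close> and \<open>0 powr d = 0\<close>.\<close>
      define U where "U i = (if i < card F then cball (h i) (r (h i)) else {})" for i
      have hF: "h i \<in> F" if "i < card F" for i using h that by (auto simp: bij_betw_def)
      have "A \<subseteq> (\<Union>i. U i)"
      proof
        fix a assume "a \<in> A"
        then obtain x where x: "x \<in> F" "a \<in> cball x (r x)" using cov by auto
        then obtain i where "i < card F" "x = h i" using h by (auto simp: bij_betw_def)
        then show "a \<in> (\<Union>i. U i)" using x by (auto simp: U_def intro!: exI[of _ i])
      qed
      moreover have "bounded (U i) \<and> diameter (U i) \<le> \<delta>" for i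
        using True r \<delta> hF by (force simp: U_def)
      ultimately have "hausdorff_premeasure d \<delta> A \<le> (\<Sum>i. ennreal (v * (diameter (U i) / 2) powr d))"
        unfolding hausdorff_premeasure_def v_def by (intro INF_lower) auto
      also have "\<dots> = (\<Sum>i<card F. ennreal (v * (diameter (U i) / 2) powr d))"
        by (rule suminf_finite) (auto simp: U_def)
      also have "\<dots> = (\<Sum>i<card F. ennreal (v * r (h i) powr d))"
        using r hF by (intro sum.cong) (force simp: U_def)+
      also have "\<dots> = ennreal (\<Sum>i<card F. v * r (h i) powr d)"
        using v by (intro sum_ennreal) auto
      also have "(\<Sum>i<card F. v * r (h i) powr d) = (\<Sum>x\<in>F. v * r x powr d)"
        using h by (rule sum.reindex_bij_betw)
      also have "\<dots> = v * (\<Sum>x\<in>F. r x powr d)" by (simp add: sum_distrib_left)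
      finally have "ennreal m < ennreal (v * (\<Sum>x\<in>F. r x powr d))" using m(2) by order
      then have "m < v * (\<Sum>x\<in>F. r x powr d)" using m(1) by (simp add: ennreal_less_iff)
      then have "m / v \<le> (\<Sum>x\<in>F. r x powr d)" using v by (simp add: field_simps)
      then show ?thesis by (simp add: \<kappa>_def)
    qed
  qed
qed

text \<open>If every y in \<open>A\<close> had a ball with too many indices, Vitali's lemma would
  select disjoint such balls whose fivefold enlargements cover \<open>A\<close>. Disjointness bounds
  the total count by \<open>card J\<close>, hence the sum of (5 r)^d by \<kappa>/2, against the
  content bound. The factor 2 in the constant makes the contradiction strict. Indices are counted,
  so points may coincide.\<close>

lemma exists_point_counting:
  fixes A :: "'a::euclidean_space set" and x :: "'i \<Rightarrow> 'a"
  assumes d: "0 < d" and \<kappa>: "0 < \<kappa>"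
    and cover: "\<And>(F::'a set) r. \<lbrakk>finite F; \<And>x. x \<in> F \<Longrightarrow> 0 \<le> r x; A \<subseteq> (\<Union>x\<in>F. cball x (r x))\<rbrakk>
        \<Longrightarrow> \<kappa> \<le> (\<Sum>x\<in>F. r x powr d)"
    and J: "finite J" "J \<noteq> {}"
  shows "\<exists>y\<in>A. \<forall>r>0. real (card {j\<in>J. norm (y - x j) \<le> r}) \<le> 2 * 5 powr d / \<kappa> * real (card J) * r powr d"
proof (rule ccontr)
  define K where "K = 2 * 5 powr d / \<kappa> * real (card J)"
  have cJ: "card J > 0" using J by (simp add: card_gt_0_iff)
  have K: "K > 0" using \<kappa> cJ by (simp add: K_def)
  define P where "P y r = {j\<in>J. x j \<in> cball y r}" for y r
  have P: "P y r = {j\<in>J. norm (y - x j) \<le> r}" for y r by (auto simp: P_def dist_norm)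
  assume "\<not> ?thesis"
  then have "\<forall>y\<in>A. \<exists>r>0. K * r powr d < real (card (P y r))"
    by (simp add: K_def P not_le)
  then obtain r where r: "\<And>y. y \<in> A \<Longrightarrow> 0 < r y" "\<And>y. y \<in> A \<Longrightarrow> K * r y powr d < real (card (P y (r y)))"
    by metis
  \<comment> \<open>Vitali's lemma needs bounded radii: an overfull ball holds at most
    \<open>card J\<close> indices, which caps its radius.\<close>
  define B where "B = (real (card J) / K) powr (1 / d)"
  have rB: "0 < r y \<and> r y \<le> B" if "y \<in> A" for y
  proof -
    have "card (P y (r y)) \<le> card J" using J by (intro card_mono) (auto simp: P_def)
    then have "K * r y powr d \<le> real (card J)" using r(2)[OF that] by linarith
    then have "r y powr d \<le> real (card J) / K" using K by (simp add: field_simps)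
    then have "(r y powr d) powr (1 / d) \<le> B" unfolding B_def using d by (intro powr_mono2) auto
    then show ?thesis using r(1)[OF that] d by (simp add: powr_powr)
  qed
  have "A \<subseteq> (\<Union>i\<in>A. cball i (r i))" using r by (force intro: less_imp_le)
  from Vitali_covering_lemma_cballs[where a="\<lambda>y. y" and K=A and r=r, OF this rB]
  obtain C where C: "C \<subseteq> A"
     "pairwise (\<lambda>i j. disjnt (cball i (r i)) (cball j (r j))) C"
     "A \<subseteq> (\<Union>i\<in>C. cball i (5 * r i))" by this
  have sumle: "(\<Sum>y\<in>G. card (P y (r y))) \<le> card J" if G: "finite G" "G \<subseteq> C" for G
  proof -
    have "(\<Sum>y\<in>G. card (P y (r y))) = card (\<Union>y\<in>G. P y (r y))"
    proof (rule card_UN_disjoint[symmetric])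
      show "\<forall>i\<in>G. finite (P i (r i))" using J by (auto simp: P_def)
      show "\<forall>i\<in>G. \<forall>j\<in>G. i \<noteq> j \<longrightarrow> P i (r i) \<inter> P j (r j) = {}"
        using C(2) G unfolding pairwise_def disjnt_def P_def by blast
    qed (use G in auto)
    also have "\<dots> \<le> card J" using J by (intro card_mono) (auto simp: P_def)
    finally show ?thesis .
  qed
  \<comment> \<open>The content bound speaks of finite covers; each selected ball holds at least one
    index, so at most \<open>card J\<close> balls are selected.\<close>
  have "card G \<le> card J" if G: "G \<subseteq> C" "finite G" for G
  proof -
    have "(\<Sum>y\<in>G. 1) \<le> (\<Sum>y\<in>G. card (P y (r y)))"
    proof (rule sum_mono)
      fix y assume "y \<in> G"
      then have "y \<in> A" using G C by auto
      then have "0 < K * r y powr d" using r(1)[of y] K by simp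
      then show "1 \<le> card (P y (r y))" using r(2)[OF \<open>y \<in> A\<close>] by linarith
    qed
    then show ?thesis using sumle[OF G(2,1)] by simp
  qed
  then have fC: "finite C" using finite_if_finite_subsets_card_bdd by blast
  have "\<kappa> \<le> (\<Sum>y\<in>C. (5 * r y) powr d)"
    using C r fC by (intro cover) (force intro: less_imp_le)+
  also have "\<dots> = 5 powr d * (\<Sum>y\<in>C. r y powr d)"
    by (simp add: sum_distrib_left powr_mult)
  finally have "\<kappa> \<le> 5 powr d * (\<Sum>y\<in>C. r y powr d)" .
  moreover have "K * (\<Sum>y\<in>C. r y powr d) \<le> real (card J)"
  proof -
    have "K * (\<Sum>y\<in>C. r y powr d) \<le> (\<Sum>y\<in>C. real (card (P y (r y))))"
      unfolding sum_distrib_left using C r by (intro sum_mono) (force intro: less_imp_le)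
    also have "\<dots> \<le> real (card J)" using sumle[OF fC] by (simp flip: of_nat_sum)
    finally show ?thesis .
  qed
  moreover have "K * (\<Sum>y\<in>C. r y powr d) = 2 * real (card J) / \<kappa> * (5 powr d * (\<Sum>y\<in>C. r y powr d))"
    by (simp add: K_def)
  ultimately have "2 * real (card J) / \<kappa> * \<kappa> \<le> real (card J)"
    using \<kappa> by (smt (verit) divide_nonneg_pos mult_left_mono of_nat_0_le_iff)
  then show False using \<kappa> cJ by simp
qed

section \<open>Riesz potentials and separation of greedy points\<close>

lemma sum_riesz_kernel:
  assumes "finite J" "\<And>j. j \<in> J \<Longrightarrow> x j \<noteq> y"
  shows "(\<Sum>j\<in>J. riesz_kernel s y (x j)) = ennreal (\<Sum>j\<in>J. norm (y - x j) powr (- s))"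
proof -
  have "(\<Sum>j\<in>J. riesz_kernel s y (x j)) = (\<Sum>j\<in>J. ennreal (norm (y - x j) powr (- s)))"
    using assms(2) by (intro sum.cong) (metis powr_minus inverse_eq_divide riesz_kernel_off_diag)+
  then show ?thesis by (simp add: sum_ennreal)
qed

text \<open>A point equal to y would be counted at every radius, while L r^d tends to 0.\<close>

lemma counting_imp_neq:
  fixes y :: "'a::real_normed_vector"
  assumes "finite J" "0 < d" "j \<in> J"
    and cnt: "\<And>r. 0 < r \<Longrightarrow> real (card {j\<in>J. norm (y - x j) \<le> r}) \<le> L * r powr d"
  shows "x j \<noteq> y"
proof
  assume eq: "x j = y"
  define r where "r = (1 / (2 * max L 1)) powr (1 / d)"
  have r: "r > 0" by (simp add: r_def max_def)
  have rd: "r powr d = 1 / (2 * max L 1)" using assms(2) by (simp add: r_def powr_powr)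
  have "card {j} \<le> card {j\<in>J. norm (y - x j) \<le> r}"
    using assms eq r by (intro card_mono) auto
  then have "1 \<le> L * r powr d" using cnt[OF r] by simp
  also have "\<dots> \<le> max L 1 * r powr d" by (intro mult_right_mono) auto
  also have "\<dots> = 1 / 2" using rd by (simp add: field_simps max_def)
  finally show False by simp
qed

lemma sum_riesz_kernel_le_of_counting:
  fixes y :: "'a::real_normed_vector"
  assumes "finite J" "0 < d" "d < s"
    and cnt: "\<And>r. 0 < r \<Longrightarrow> real (card {j\<in>J. norm (y - x j) \<le> r}) \<le> L * r powr d"
  shows "(\<Sum>j\<in>J. riesz_kernel s y (x j)) \<le> ennreal (L powr (s / d) * (\<Sum>k. real k powr (- (s / d))))"
proof -
  have ne: "x j \<noteq> y" if "j \<in> J" for j using counting_imp_neq[OF assms(1,2) that cnt] .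
  have "(\<Sum>j\<in>J. norm (y - x j) powr (- s)) \<le> L powr (s / d) * (\<Sum>k. real k powr (- (s / d)))"
    using assms ne by (intro sum_powr_le_of_counting_suminf) force+
  then show ?thesis using sum_riesz_kernel[OF assms(1), of x y s] ne by (simp add: ennreal_leI)
qed

lemma riesz_kernel_leD:
  assumes "0 < s" "0 < B" "riesz_kernel s x y \<le> ennreal B"
  shows "B powr (- 1 / s) \<le> norm (x - y)"
proof -
  have ne: "x \<noteq> y" using assms(3) riesz_kernel_diag[of s x] by (auto simp: top_unique)
  then have n: "0 < norm (x - y)" by simp
  have "1 / norm (x - y) powr s \<le> B"
    using assms ne by (simp add: riesz_kernel_off_diag)
  then have "1 / B \<le> norm (x - y) powr s" using n assms by (simp add: field_simps)
  then have "(1 / B) powr (1 / s) \<le> (norm (x - y) powr s) powr (1 / s)"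
    using assms by (intro powr_mono2) auto
  then show ?thesis using n assms by (simp add: powr_powr powr_divide powr_minus inverse_eq_divide)
qed

text \<open>The term of \<open>a i\<close> in the potential at \<open>a j\<close> is at most the
  whole sum, which the greedy choice keeps below the potential at a sparsely surrounded point of
  \<open>A\<close>. The constants depend on \<open>A\<close>, d and s only, so c serves every
  sequence.\<close>

lemma greedy_separation:
  fixes A :: "'a::euclidean_space set"
  assumes d: "0 < d" and H: "hausdorff_measure d A > 0" and s: "d < s"
  shows "\<exists>c>0. \<forall>a. greedy_energy_sequence s A a \<longrightarrow>
            (\<forall>i j. 1 \<le> i \<and> i < j \<longrightarrow> norm (a i - a j) \<ge> c * real j powr (- 1 / d))"
proof -
  obtain \<kappa> where \<kappa>: "0 < \<kappa>" "\<And>(F::'a set) r. \<lbrakk>finite F; \<And>x. x \<in> F \<Longrightarrow> 0 \<le> r x; A \<subseteq> (\<Union>x\<in>F. cball x (r x))\<rbrakk>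
        \<Longrightarrow> \<kappa> \<le> (\<Sum>x\<in>F. r x powr d)"
    using hausdorff_measure_pos_imp_cover[OF d H] by metis
  define K where "K = 2 * 5 powr d / \<kappa>"
  define Z where "Z = (\<Sum>k. real k powr (- (s / d)))"
  have K: "K > 0" using \<kappa> by (simp add: K_def)
  have Z: "Z > 0" using suminf_powr_pos[OF d s] by (simp add: Z_def)
  \<comment> \<open>The factor left when j^(-1/d) is split off from \<open>B powr (- 1 / s)\<close>,
    with \<open>B\<close> the bound on the potential at step j.\<close>
  define c where "c = (K powr (s / d) * Z) powr (- 1 / s)"
  have c: "c > 0" using K Z by (simp add: c_def)
  have "norm (a i - a j) \<ge> c * real j powr (- 1 / d)"
    if a: "greedy_energy_sequence s A a" and ij: "1 \<le> i" "i < j" for a i j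
  proof -
    define B where "B = (K * real j) powr (s / d) * Z"
    have B: "B > 0" using K Z ij by (simp add: B_def)
    have J: "finite {1..j-1}" "{1..j-1} \<noteq> {}" "card {1..j-1} = j - 1" using ij by auto
    obtain y where y: "y \<in> A"
      "\<And>r. r > 0 \<Longrightarrow> real (card {k\<in>{1..j-1}. norm (y - a k) \<le> r}) \<le> K * real (card {1..j-1}) * r powr d"
      using exists_point_counting[OF d \<kappa> J(1,2), where x=a] unfolding K_def by blast
    have cnt: "real (card {k\<in>{1..j-1}. norm (y - a k) \<le> r}) \<le> K * real j * r powr d" if "r > 0" for r
    proof -
      have "K * real (card {1..j-1}) * r powr d \<le> K * real j * r powr d"
        using K by (intro mult_right_mono mult_left_mono) auto
      then show ?thesis using y(2)[OF that] by linarith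
    qed
    have "riesz_kernel s (a j) (a i) \<le> (\<Sum>k=1..j-1. riesz_kernel s (a j) (a k))"
      using ij by (intro member_le_sum) auto
    also have "\<dots> = (INF y\<in>A. \<Sum>k=1..j-1. riesz_kernel s y (a k))"
      using a ij by (simp add: greedy_energy_sequence_def)
    also have "\<dots> \<le> (\<Sum>k=1..j-1. riesz_kernel s y (a k))"
      using y(1) by (rule INF_lower)
    also have "\<dots> \<le> ennreal B"
      unfolding B_def Z_def using cnt by (intro sum_riesz_kernel_le_of_counting[OF J(1) d s])
    finally have "B powr (- 1 / s) \<le> norm (a j - a i)"
      using d s B by (intro riesz_kernel_leD) auto
    also have "B powr (- 1 / s) = c * real j powr (- 1 / d)"
      using K Z d s by (simp add: B_def c_def powr_mult powr_powr)
    finally show ?thesis by (simp add: norm_minus_commute)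
  qed
  then show ?thesis using c by blast
qed

section \<open>Packing in regular sets and in neighbourhoods\<close>

text \<open>Balls of radius \<rho> about 2\<rho>-separated centres are disjoint, so their masses add
  up. This serves both the regular measure and Lebesgue measure.\<close>

lemma packing_card_le:
  fixes \<mu> :: "'a::metric_space measure" and x :: "'i \<Rightarrow> 'a"
  assumes J: "finite J" and \<mu>: "sets \<mu> = sets borel" and E: "E \<in> sets \<mu>"
    and sep: "\<And>i j. \<lbrakk>i \<in> J; j \<in> J; i \<noteq> j\<rbrakk> \<Longrightarrow> 2 * \<rho> \<le> dist (x i) (x j)"
    and m: "\<And>j. j \<in> J \<Longrightarrow> m \<le> emeasure \<mu> (ball (x j) \<rho>)"
    and sub: "\<And>j. j \<in> J \<Longrightarrow> ball (x j) \<rho> \<subseteq> E"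
  shows "of_nat (card J) * m \<le> emeasure \<mu> E"
proof -
  have disj: "disjoint_family_on (\<lambda>j. ball (x j) \<rho>) J"
    unfolding disjoint_family_on_def
  proof (intro ballI impI equals0I)
    fix i j z assume "i \<in> J" "j \<in> J" "i \<noteq> j" "z \<in> ball (x i) \<rho> \<inter> ball (x j) \<rho>"
    then show False
      using sep[of i j] dist_triangle[of "x i" "x j" z] by (auto simp: dist_commute)
  qed
  have "of_nat (card J) * m = (\<Sum>j\<in>J. m)" by simp
  also have "\<dots> \<le> (\<Sum>j\<in>J. emeasure \<mu> (ball (x j) \<rho>))" by (intro sum_mono m)
  also have "\<dots> = emeasure \<mu> (\<Union>j\<in>J. ball (x j) \<rho>)"
    using disj J by (intro sum_emeasure) (simp_all add: \<mu> image_subset_iff)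
  also have "\<dots> \<le> emeasure \<mu> E" using sub E by (intro emeasure_mono UN_least)
  finally show ?thesis .
qed

text \<open>The upper regularity bound is extended to all radii: from the diameter on, the finite
  total mass is absorbed into the constant.\<close>

lemma d_regularE:
  fixes S :: "'a::euclidean_space set"
  assumes "d_regular d S" and D: "0 < diameter S" and d: "0 < d"
  obtains \<mu> :: "'a measure" and C where "finite_measure \<mu>" "sets \<mu> = sets borel" "0 < C"
    "\<And>x r. \<lbrakk>x \<in> S; 0 < r; r < diameter S\<rbrakk> \<Longrightarrow> r powr d / C \<le> measure \<mu> (ball x r)"
    "\<And>x r. \<lbrakk>x \<in> S; 0 < r\<rbrakk> \<Longrightarrow> measure \<mu> (ball x r) \<le> C * r powr d"
proof -
  obtain \<mu> :: "'a measure" and C where \<mu>: "finite_measure \<mu>" "sets \<mu> = sets borel" and C: "0 < C"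
    and reg: "\<And>x r. \<lbrakk>x \<in> S; 0 < r; r < diameter S\<rbrakk> \<Longrightarrow>
        inverse C * r powr d \<le> measure \<mu> (ball x r) \<and> measure \<mu> (ball x r) \<le> C * r powr d"
    using assms(1) unfolding d_regular_def by blast
  interpret finite_measure \<mu> by fact
  define C' where "C' = max C (measure \<mu> (space \<mu>) / diameter S powr d)"
  have C': "C \<le> C'" "0 < C'" using C by (auto simp: C'_def)
  show thesis
  proof (rule that[OF \<mu> C'(2)])
    fix x and r :: real assume x: "x \<in> S" and r: "0 < r"
    show "r powr d / C' \<le> measure \<mu> (ball x r)" if "r < diameter S"
    proof -
      have "r powr d / C' \<le> r powr d / C" using C C' by (intro divide_left_mono) auto
      then show ?thesis using reg[OF x r that] by (simp add: field_simps)
    qed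
    show "measure \<mu> (ball x r) \<le> C' * r powr d"
    proof (cases "r < diameter S")
      case True
      then have "measure \<mu> (ball x r) \<le> C * r powr d" using reg[OF x r] by blast
      also have "\<dots> \<le> C' * r powr d" using C' by (intro mult_right_mono) auto
      finally show ?thesis .
    next
      case False
      have "measure \<mu> (ball x r) \<le> measure \<mu> (space \<mu>)" by (rule bounded_measure)
      also have "\<dots> = measure \<mu> (space \<mu>) / diameter S powr d * diameter S powr d" using D by simp
      also have "\<dots> \<le> C' * r powr d"
        using False D d C' by (intro mult_mono powr_mono2) (auto simp: C'_def)
      finally show ?thesis .
    qed
  qed
qed

text \<open>Balls of radius comparable to N^(-1/d) about the counted points are disjoint, carry mass
  at least a multiple of 1/N each, and lie in the ball of radius 2r about y, whose mass is at most C
  (2r)^d.\<close>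

lemma counting_of_separated:
  fixes S :: "'a::euclidean_space set"
  assumes S: "d_regular d S" and D: "0 < diameter S" and d: "0 < d" and c: "0 < c"
  obtains L where "0 < L"
    "\<And>(J::'i set) x y N r. \<lbrakk>finite J; 0 < (N::nat); y \<in> S; \<And>j. j \<in> J \<Longrightarrow> x j \<in> S; 0 < r;
        \<And>i j. \<lbrakk>i \<in> J; j \<in> J; i \<noteq> j\<rbrakk> \<Longrightarrow> c * real N powr (- 1 / d) \<le> norm (x i - x j);
        \<And>j. j \<in> J \<Longrightarrow> c * real N powr (- 1 / d) \<le> norm (y - x j)\<rbrakk>
       \<Longrightarrow> real (card {j\<in>J. norm (y - x j) \<le> r}) \<le> L * real N * r powr d"
proof -
  obtain \<mu> :: "'a measure" and C where \<mu>: "finite_measure \<mu>" "sets \<mu> = sets borel" and C: "0 < C"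
    and lo: "\<And>x r. \<lbrakk>x \<in> S; 0 < r; r < diameter S\<rbrakk> \<Longrightarrow> r powr d / C \<le> measure \<mu> (ball x r)"
    and up: "\<And>x r. \<lbrakk>x \<in> S; 0 < r\<rbrakk> \<Longrightarrow> measure \<mu> (ball x r) \<le> C * r powr d"
    by (rule d_regularE[OF S D d]) blast
  interpret finite_measure \<mu> by fact
  \<comment> \<open>The lower regularity bound holds only below the diameter; capping c by it
    ensures \<open>\<rho> < diameter S\<close>.\<close>
  define c' where "c' = min c (diameter S)"
  have c': "0 < c'" using c D by (simp add: c'_def)
  define L where "L = C * C * (4 / c') powr d"
  show thesis
  proof (rule that)
    show "0 < L" using C c' by (simp add: L_def)
    fix J :: "'i set" and x y and r :: real and N :: nat
    assume J: "finite J" and N: "0 < N" and y: "y \<in> S" and x: "\<And>j. j \<in> J \<Longrightarrow> x j \<in> S" and r: "0 < r"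
      and sep: "\<And>i j. \<lbrakk>i \<in> J; j \<in> J; i \<noteq> j\<rbrakk> \<Longrightarrow> c * real N powr (- 1 / d) \<le> norm (x i - x j)"
      and far: "\<And>j. j \<in> J \<Longrightarrow> c * real N powr (- 1 / d) \<le> norm (y - x j)"
    define I where "I = {j\<in>J. norm (y - x j) \<le> r}"
    define \<rho> where "\<rho> = c' * real N powr (- 1 / d) / 2"
    have \<rho>: "0 < \<rho>" using c' N by (simp add: \<rho>_def)
    have N1: "real N powr (- 1 / d) \<le> 1"
      using N d powr_mono2'[of "- 1 / d" 1 "real N"] by simp
    have "\<rho> \<le> c' * 1 / 2" unfolding \<rho>_def using N1 c' by (intro divide_right_mono mult_left_mono) auto
    also have "\<dots> < diameter S" using c' D by (simp add: c'_def)
    finally have \<rho>D: "\<rho> < diameter S" .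
    have \<rho>2: "2 * \<rho> \<le> c * real N powr (- 1 / d)"
      unfolding \<rho>_def by (simp add: c'_def mult_right_mono)
    have \<rho>d: "\<rho> powr d = (c' / 2) powr d / real N"
    proof -
      have "\<rho> = (c' / 2) * real N powr (- 1 / d)" by (simp add: \<rho>_def)
      then have "\<rho> powr d = (c' / 2) powr d * (real N powr (- 1 / d)) powr d"
        by (simp only: powr_mult)
      moreover have "(real N powr (- 1 / d)) powr d = 1 / real N"
        using N d by (simp add: powr_powr powr_neg_one)
      ultimately show ?thesis by simp
    qed
    have "real (card I) \<le> L * real N * r powr d"
    proof (cases "I = {}")
      case True
      then show ?thesis using C c' by (simp add: L_def)
    next
      case False
      then obtain i where "i \<in> J" "norm (y - x i) \<le> r" by (auto simp: I_def)
      \<comment> \<open>A counted point is at least 2\<rho> away from y, so a nonempty count forces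
        r \<ge> 2\<rho>, and the small balls fit into \<open>ball y (2 * r)\<close>.\<close>
      then have \<rho>r: "2 * \<rho> \<le> r" using far[of i] \<rho>2 by linarith
      have "of_nat (card I) * ennreal (\<rho> powr d / C) \<le> emeasure \<mu> (ball y (2 * r))"
      proof (rule packing_card_le)
        show "finite I" using J by (simp add: I_def)
        show "2 * \<rho> \<le> dist (x i) (x j)" if "i \<in> I" "j \<in> I" "i \<noteq> j" for i j
          using sep[of i j] that \<rho>2 by (auto simp: I_def dist_norm)
        show "ennreal (\<rho> powr d / C) \<le> emeasure \<mu> (ball (x j) \<rho>)" if "j \<in> I" for j
          using lo[OF x \<rho> \<rho>D] that by (simp add: emeasure_eq_measure I_def)
        show "ball (x j) \<rho> \<subseteq> ball y (2 * r)" if "j \<in> I" for j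
        proof -
          have "dist y (x j) \<le> r" using that by (simp add: I_def dist_norm)
          then show ?thesis
            using \<rho>r \<rho> by (simp add: ball_subset_ball_iff dist_commute)
        qed
      qed (use \<mu> in auto)
      then have "real (card I) * (\<rho> powr d / C) \<le> measure \<mu> (ball y (2 * r))"
        using C by (simp add: emeasure_eq_measure ennreal_of_nat_eq_real_of_nat flip: ennreal_mult)
      also have "\<dots> \<le> C * (2 * r) powr d" using r by (intro up y) auto
      finally have "real (card I) * ((c' / 2) powr d / real N / C) \<le> C * (2 * r) powr d"
        by (simp add: \<rho>d)
      moreover have "(c' / 2) powr d > 0" using c' by simp
      ultimately have "real (card I) \<le> C * (2 * r) powr d * C * real N / (c' / 2) powr d"
        using C N by (simp add: field_simps)
      also have "\<dots> = L * real N * r powr d"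
      proof -
        have "(4 / c') powr d * (c' / 2) powr d = 2 powr d"
          using c' by (simp flip: powr_mult)
        then have "(4 / c') powr d = 2 powr d / (c' / 2) powr d"
          using \<open>(c' / 2) powr d > 0\<close> by (simp add: eq_divide_eq)
        then show ?thesis using r by (simp add: L_def powr_mult)
      qed
      finally show ?thesis .
    qed
    then show "real (card {j\<in>J. norm (y - x j) \<le> r}) \<le> L * real N * r powr d"
      by (simp add: I_def)
  qed
qed

text \<open>The disjoint \<epsilon>-balls about the points lie in the \<epsilon>-neighbourhood of
  \<open>A\<close>, whose volume is at most a multiple of \<epsilon>^(p-d); dividing by the ball
  volume, a multiple of \<epsilon>^p, leaves \<epsilon>^(-d). A limsup controls only small
  \<epsilon>, hence \<open>\<epsilon>\<^sub>0\<close>.\<close>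

lemma minkowski_packing:
  fixes A :: "'a::euclidean_space set"
  assumes d: "d \<le> real DIM('a)" and fin: "upper_minkowski_content d A < \<infinity>"
  obtains P \<epsilon>\<^sub>0 where "0 < P" "0 < \<epsilon>\<^sub>0"
    "\<And>(J::'i set) x \<epsilon>. \<lbrakk>finite J; 0 < \<epsilon>; \<epsilon> < \<epsilon>\<^sub>0; \<And>j. j \<in> J \<Longrightarrow> x j \<in> A;
        \<And>i j. \<lbrakk>i \<in> J; j \<in> J; i \<noteq> j\<rbrakk> \<Longrightarrow> 2 * \<epsilon> \<le> dist (x i) (x j)\<rbrakk>
      \<Longrightarrow> real (card J) \<le> P * \<epsilon> powr (- d)"
proof -
  define p where "p = real DIM('a)"
  define v where "v = unit_ball_vol (p - d)"
  define w where "w = unit_ball_vol p"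
  have v: "v > 0" using d by (simp add: v_def p_def)
  have w: "w > 0" by (simp add: w_def p_def)
  \<comment> \<open>A finite z strictly above the limsup eventually exceeds the quotient; strictness
    also makes \<open>M\<close> positive.\<close>
  obtain z where z: "upper_minkowski_content d A < z" "z < \<infinity>" using dense[OF fin] by blast
  define M where "M = enn2real z"
  have zM: "z = ennreal M" using z by (simp add: M_def less_top)
  have M: "M > 0" using z by (auto simp: M_def enn2real_positive_iff less_top intro: le_less_trans)
  have "\<forall>\<^sub>F \<epsilon> in at_right 0. emeasure lborel {x. infdist x A < \<epsilon>} / ennreal (v * \<epsilon> powr (p - d)) < z"
    using Limsup_lessD[OF z(1)[unfolded upper_minkowski_content_def]] by (simp add: v_def p_def)
  then obtain \<epsilon>\<^sub>0 where \<epsilon>\<^sub>0: "\<epsilon>\<^sub>0 > 0"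
    and E: "\<And>\<epsilon>. 0 < \<epsilon> \<Longrightarrow> \<epsilon> < \<epsilon>\<^sub>0 \<Longrightarrow> emeasure lborel {x. infdist x A < \<epsilon>} / ennreal (v * \<epsilon> powr (p - d)) < z"
    by (auto simp: eventually_at_right_field)
  show thesis
  proof (rule that)
    show "0 < M * v / w" using M v w by simp
    show "0 < \<epsilon>\<^sub>0" by fact
    fix J :: "'i set" and x \<epsilon>
    assume J: "finite J" and \<epsilon>: "0 < \<epsilon>" "\<epsilon> < \<epsilon>\<^sub>0" and x: "\<And>j. j \<in> J \<Longrightarrow> x j \<in> A"
      and sep: "\<And>i j. \<lbrakk>i \<in> J; j \<in> J; i \<noteq> j\<rbrakk> \<Longrightarrow> 2 * \<epsilon> \<le> dist (x i) (x j)"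
    have "of_nat (card J) * ennreal (w * \<epsilon> powr p) \<le> emeasure lborel {x. infdist x A < \<epsilon>}"
    proof (rule packing_card_le)
      have "open {x. infdist x A < \<epsilon>}" by (intro open_Collect_less continuous_intros)
      then show "{x. infdist x A < \<epsilon>} \<in> sets lborel" by simp
      show "ennreal (w * \<epsilon> powr p) \<le> emeasure lborel (ball (x j) \<epsilon>)" for j
        using \<epsilon> by (simp add: emeasure_ball w_def p_def powr_realpow)
      show "ball (x j) \<epsilon> \<subseteq> {x. infdist x A < \<epsilon>}" if "j \<in> J" for j
        using le_less_trans[OF infdist_le[OF x[OF that]]] by (auto simp: dist_commute)
    qed (use J sep in auto)
    also have "\<dots> \<le> z * ennreal (v * \<epsilon> powr (p - d))"
      using E[OF \<epsilon>] v \<epsilon> by (subst (asm) divide_less_ennreal) auto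
    finally have "real (card J) * (w * \<epsilon> powr p) \<le> M * (v * \<epsilon> powr (p - d))"
      using M w v by (simp add: zM ennreal_of_nat_eq_real_of_nat flip: ennreal_mult)
    also have "\<epsilon> powr (p - d) = \<epsilon> powr p * \<epsilon> powr (- d)"
      by (simp flip: powr_add)
    finally have "\<epsilon> powr p * (real (card J) * w) \<le> \<epsilon> powr p * (M * v * \<epsilon> powr (- d))"
      by (simp only: mult_ac)
    then have "real (card J) * w \<le> M * v * \<epsilon> powr (- d)"
      using \<epsilon> by (subst (asm) mult_le_cancel_left_pos) auto
    then show "real (card J) \<le> M * v / w * \<epsilon> powr (- d)"
      using w by (simp add: field_simps)
  qed
qed

section \<open>Lower bound for the greedy potential\<close>

lemma riesz_kernel_ge:
  assumes "0 < s" "norm (x - y) < t"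
  shows "ennreal (t powr (- s)) \<le> riesz_kernel s x y"
proof (cases "x = y")
  case True
  then show ?thesis by (simp add: riesz_kernel_diag)
next
  case False
  then have "t powr (- s) \<le> norm (x - y) powr (- s)"
    using assms by (intro powr_mono2') auto
  then show ?thesis using False
    by (simp add: riesz_kernel_off_diag powr_minus inverse_eq_divide ennreal_leI)
qed

text \<open>For a suitable \<epsilon> of order N^(-1/d), at most N/2 points of \<open>A\<close> can
  be 2\<epsilon>-separated. So some \<open>a j\<close> has a predecessor within 2\<epsilon>, and its
  potential is already large at step j. The greedy choice turns this into a lower bound on all of
  \<open>A\<close>, and further points only increase the potential.\<close>

lemma greedy_potential_ge:
  fixes A :: "'a::euclidean_space set"
  assumes d: "0 < d" "d \<le> real DIM('a)" and s: "0 < s"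
    and fin: "upper_minkowski_content d A < \<infinity>"
  obtains b N\<^sub>0 where "0 < b"
    "\<And>a N y. \<lbrakk>greedy_energy_sequence s A a; N\<^sub>0 \<le> N; 0 < N; y \<in> A\<rbrakk>
      \<Longrightarrow> ennreal (b * real N powr (s / d)) \<le> (\<Sum>j=1..N. riesz_kernel s y (a j))"
proof (rule minkowski_packing[OF d(2) fin])
  fix P \<epsilon>\<^sub>0 :: real assume P: "0 < P" and \<epsilon>\<^sub>0: "0 < \<epsilon>\<^sub>0"
    and pack: "\<And>(J::nat set) x \<epsilon>. \<lbrakk>finite J; 0 < \<epsilon>; \<epsilon> < \<epsilon>\<^sub>0; \<And>j. j \<in> J \<Longrightarrow> x j \<in> A;
        \<And>i j. \<lbrakk>i \<in> J; j \<in> J; i \<noteq> j\<rbrakk> \<Longrightarrow> 2 * \<epsilon> \<le> dist (x i) (x j)\<rbrakk>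
      \<Longrightarrow> real (card J) \<le> P * \<epsilon> powr (- d)"
  \<comment> \<open>\<open>b\<close> satisfies (2\<epsilon>)^(-s) = b N^(s/d) for the \<epsilon>
    below, at which P \<epsilon>^(-d) = N/2. \<open>N\<^sub>0\<close> guarantees \<epsilon> <
    \<open>\<epsilon>\<^sub>0\<close>, the added 1 giving strictness.\<close>
  define b where "b = (2 * (2 * P) powr (1 / d)) powr (- s)"
  define N\<^sub>0 where "N\<^sub>0 = nat \<lceil>2 * P / \<epsilon>\<^sub>0 powr d\<rceil> + 1"
  show thesis
  proof (rule that)
    show "0 < b" using P by (simp add: b_def)
    fix a N y assume a: "greedy_energy_sequence s A a" and N: "N\<^sub>0 \<le> N" "0 < N" and y: "y \<in> A"
    define \<epsilon> where "\<epsilon> = (2 * P / real N) powr (1 / d)"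
    have \<epsilon>: "\<epsilon> > 0" using P N by (simp add: \<epsilon>_def)
    have "2 * P / \<epsilon>\<^sub>0 powr d < real N" using N(1) unfolding N\<^sub>0_def by linarith
    then have "2 * P / real N < \<epsilon>\<^sub>0 powr d" using N \<epsilon>\<^sub>0 by (simp add: field_simps)
    then have "\<epsilon> < (\<epsilon>\<^sub>0 powr d) powr (1 / d)"
      unfolding \<epsilon>_def using P N d by (intro powr_less_mono2) auto
    then have \<epsilon>1: "\<epsilon> < \<epsilon>\<^sub>0" using \<epsilon>\<^sub>0 d by (simp add: powr_powr)
    have aA: "a j \<in> A" if "1 \<le> j" for j using a that by (simp add: greedy_energy_sequence_def)
    \<comment> \<open>Comparing each point with its predecessors alone already yields a separated
      family, by symmetry of the distance.\<close>
    define J where "J = {j\<in>{1..N}. \<forall>i. 1 \<le> i \<and> i < j \<longrightarrow> 2 * \<epsilon> \<le> dist (a i) (a j)}"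
    have "2 * \<epsilon> \<le> dist (a i) (a j)" if "i \<in> J" "j \<in> J" "i \<noteq> j" for i j
      using that by (cases i j rule: linorder_cases) (auto simp: J_def dist_commute)
    then have "real (card J) \<le> P * \<epsilon> powr (- d)"
      using \<epsilon> \<epsilon>1 aA by (intro pack) (auto simp: J_def)
    also have "\<dots> = real N / 2" using P N d by (simp add: \<epsilon>_def powr_powr powr_minus_divide)
    also have "\<dots> < real N" using N by simp
    finally have "J \<noteq> {1..N}" by auto
    moreover have "J \<subseteq> {1..N}" by (auto simp: J_def)
    ultimately obtain j where j: "j \<in> {1..N}" "j \<notin> J" by blast
    then obtain i where i: "1 \<le> i" "i < j" "dist (a i) (a j) < 2 * \<epsilon>"
      by (auto simp: J_def not_le)
    have "b * real N powr (s / d) = (2 * \<epsilon>) powr (- s)"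
      using P N d by (simp add: b_def \<epsilon>_def powr_mult powr_powr powr_divide powr_minus_divide field_simps)
    then have "ennreal (b * real N powr (s / d)) \<le> riesz_kernel s (a j) (a i)"
      using riesz_kernel_ge[OF s, of "a j" "a i"] i by (simp add: dist_norm norm_minus_commute)
    also have "\<dots> \<le> (\<Sum>k=1..j-1. riesz_kernel s (a j) (a k))"
      using i by (intro member_le_sum) auto
    also have "\<dots> = (INF y\<in>A. \<Sum>k=1..j-1. riesz_kernel s y (a k))"
      using a i by (simp add: greedy_energy_sequence_def)
    also have "\<dots> \<le> (\<Sum>k=1..j-1. riesz_kernel s y (a k))"
      using y by (rule INF_lower)
    also have "\<dots> \<le> (\<Sum>k=1..N. riesz_kernel s y (a k))"
      using j by (intro sum_mono2) auto
    finally show "ennreal (b * real N powr (s / d)) \<le> (\<Sum>k=1..N. riesz_kernel s y (a k))" .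
  qed
qed

section \<open>Separation and covering radius combined\<close>

theorem corollary3p2:
  fixes A :: "'a::euclidean_space set" and d s :: real
  assumes "compact A"
    and "0 < d" and "d \<le> real DIM('a)"
    and "hausdorff_measure d A > 0"
    and "s > d"
  shows "(\<exists>c>0. \<forall>a. greedy_energy_sequence s A a \<longrightarrow>
            (\<forall>i j. 1 \<le> i \<and> i < j \<longrightarrow> norm (a i - a j) \<ge> c * real j powr (- 1 / d)))
       \<and> ((\<exists>A'. d_regular d A' \<and> A \<subseteq> A') \<and> upper_minkowski_content d A < \<infinity> \<longrightarrow>
          (\<exists>c>0. \<forall>a. greedy_energy_sequence s A a \<longrightarrow>
            (\<forall>N\<ge>2. covering_radius (a ` {1..N}) A \<le> c * real N powr (- 1 / d))))"
proof (rule conjI[OF greedy_separation[OF assms(2,4,5)]], rule impI, elim conjE exE)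
  note d = \<open>0 < d\<close>
  fix S assume S: "d_regular d S" "A \<subseteq> S" and fin: "upper_minkowski_content d A < \<infinity>"
  obtain c where c: "c > 0" and sep: "\<And>a i j. \<lbrakk>greedy_energy_sequence s A a; 1 \<le> i; i < j\<rbrakk>
      \<Longrightarrow> c * real j powr (- 1 / d) \<le> norm (a i - a j)"
    using greedy_separation[OF assms(2,4,5)] by blast
  show "\<exists>c>0. \<forall>a. greedy_energy_sequence s A a \<longrightarrow>
            (\<forall>N\<ge>2. covering_radius (a ` {1..N}) A \<le> c * real N powr (- 1 / d))"
  \<comment> \<open>Without a greedy sequence any constant works. Otherwise separation makes its
    first two points distinct, so \<open>S\<close> has positive diameter, as the use of regularity
    requires.\<close>
  proof (cases "\<exists>a. greedy_energy_sequence s A a")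
    case False
    then show ?thesis by (intro exI[of _ 1]) auto
  next
    case True
    then obtain a\<^sub>0 where a\<^sub>0: "greedy_energy_sequence s A a\<^sub>0" by blast
    have bS: "bounded S" using S by (simp add: d_regular_def compact_imp_bounded)
    have "0 < c * real 2 powr (- 1 / d)" using c by simp
    also have "\<dots> \<le> dist (a\<^sub>0 1) (a\<^sub>0 2)"
      using sep[OF a\<^sub>0, of 1 2] by (simp add: dist_norm)
    also have "\<dots> \<le> diameter S"
      using a\<^sub>0 S bS by (intro diameter_bounded_bound) (auto simp: greedy_energy_sequence_def)
    finally have D: "0 < diameter S" .
    obtain b N\<^sub>0 where b: "0 < b" and pot:
      "\<And>a N y. \<lbrakk>greedy_energy_sequence s A a; N\<^sub>0 \<le> N; 0 < N; y \<in> A\<rbrakk>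
        \<Longrightarrow> ennreal (b * real N powr (s / d)) \<le> (\<Sum>j=1..N. riesz_kernel s y (a j))"
      using greedy_potential_ge[OF d assms(3) _ fin, of s] d assms(5) by (metis less_trans)
    \<comment> \<open>Any exponent strictly between d and s would do: s' > d keeps the series
      finite, and s' < s leaves a negative power of the covering radius.\<close>
    define s' where "s' = (s + d) / 2"
    have s': "d < s'" "s' < s" using assms(5) by (auto simp: s'_def)
    define Z where "Z = (\<Sum>k. real k powr (- (s' / d)))"
    have Z: "0 < Z" using suminf_powr_pos[OF d s'(1)] by (simp add: Z_def)
    show ?thesis
    proof (rule counting_of_separated[OF S(1) D d c])
      fix L assume L: "0 < L" and count:
        "\<And>(J::nat set) x y N r. \<lbrakk>finite J; 0 < (N::nat); y \<in> S; \<And>j. j \<in> J \<Longrightarrow> x j \<in> S; 0 < r;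
          \<And>i j. \<lbrakk>i \<in> J; j \<in> J; i \<noteq> j\<rbrakk> \<Longrightarrow> c * real N powr (- 1 / d) \<le> norm (x i - x j);
          \<And>j. j \<in> J \<Longrightarrow> c * real N powr (- 1 / d) \<le> norm (y - x j)\<rbrakk>
         \<Longrightarrow> real (card {j\<in>J. norm (y - x j) \<le> r}) \<le> L * real N * r powr d"
      \<comment> \<open>The potential bounds b N^(s/d) and L^(s'/d) Z \<eta>^(s'-s) N^(s'/d) agree
        at \<eta> = c2 N^(-1/d). For N < \<open>N\<^sub>0\<close>, \<eta> \<le>
        \<open>diameter S\<close> \<le> c3 N^(-1/d).\<close>
      define c2 where "c2 = (L powr (s' / d) * Z / b) powr (1 / (s - s'))"
      define c3 where "c3 = diameter S * real N\<^sub>0 powr (1 / d)"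
      have c2: "0 < c2" using L Z b by (simp add: c2_def)
      have c3: "0 \<le> c3" using D by (simp add: c3_def)
      have "covering_radius (a ` {1..N}) A \<le> (c + c2 + c3) * real N powr (- 1 / d)"
        if a: "greedy_energy_sequence s A a" and N: "2 \<le> N" for a N
      proof -
        have aA: "a j \<in> A" if "1 \<le> j" for j using a that by (simp add: greedy_energy_sequence_def)
        define X where "X = a ` {1..N}"
        have X: "finite X" "X \<noteq> {}" using N by (auto simp: X_def)
        define \<eta> where "\<eta> = covering_radius X A"
        have "A \<noteq> {}" using aA[of 1] by auto
        then obtain y where y: "y \<in> A" and \<eta>y: "\<eta> = (MIN x\<in>X. norm (y - x))"
          by (rule covering_radius_attained[OF assms(1) _ X]) (rule that, assumption, simp only: \<eta>_def)
        have far: "\<eta> \<le> norm (y - a j)" if "j \<in> {1..N}" for j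
          unfolding \<eta>y using X that by (intro Min_le) (auto simp: X_def)
        define q where "q = real N powr (- 1 / d)"
        have q: "q > 0" using N by (simp add: q_def)
        \<comment> \<open>When the first alternative fails, y keeps distance c q from all greedy
          points, as \<open>count\<close> requires; when the third fails, N is large enough for
          \<open>pot\<close>.\<close>
        have "\<eta> \<le> c * q \<or> \<eta> \<le> c2 * q \<or> \<eta> \<le> c3 * q"
        proof (rule disjCI, rule ccontr)
          assume *: "\<not> (\<eta> \<le> c2 * q \<or> \<eta> \<le> c3 * q)" and **: "\<not> \<eta> \<le> c * q"
          have big: "N\<^sub>0 \<le> N"
          proof (rule ccontr)
            assume "\<not> N\<^sub>0 \<le> N"
            then have "1 \<le> real N\<^sub>0 / real N" using N by simp
            then have "1 \<le> (real N\<^sub>0 / real N) powr (1 / d)" using d by (intro ge_one_powr_ge_zero) auto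
            then have "diameter S * 1 \<le> diameter S * (real N\<^sub>0 / real N) powr (1 / d)"
              using D by (intro mult_left_mono) auto
            also have "\<dots> = c3 * q"
              by (simp add: c3_def q_def powr_divide powr_minus_divide)
            finally have "diameter S \<le> c3 * q" by simp
            moreover have "\<eta> \<le> norm (y - a 1)" using N by (intro far) auto
            moreover have "norm (y - a 1) \<le> diameter S"
              using diameter_bounded_bound[OF bS, of y "a 1"] y aA[of 1] S(2) by (auto simp: dist_norm)
            ultimately show False using * by auto
          qed
          have \<eta>: "\<eta> > c * q" "\<eta> > 0" using ** c q by (auto intro: less_trans[of 0 "c * q"])
          have cnt: "real (card {j\<in>{1..N}. norm (y - a j) \<le> r}) \<le> L * real N * r powr d" if r: "r > 0" for r
          proof (rule count)
            fix i j assume ij: "i \<in> {1..N}" "j \<in> {1..N}" "i \<noteq> j"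
            \<comment> \<open>Separation at the larger index j \<le> N is weakened to the common
              scale N^(-1/d).\<close>
            have *: "c * real N powr (- 1 / d) \<le> norm (a i - a j)" if "i \<in> {1..N}" "j \<in> {1..N}" "i < j" for i j
            proof -
              have "real N powr (- 1 / d) \<le> real j powr (- 1 / d)"
                using that d by (intro powr_mono2') auto
              then have "c * real N powr (- 1 / d) \<le> c * real j powr (- 1 / d)"
                using c by (intro mult_left_mono) auto
              then show ?thesis using sep[OF a, of i j] that by auto
            qed
            show "c * real N powr (- 1 / d) \<le> norm (a i - a j)"
              using *[of i j] *[of j i] ij by (cases i j rule: linorder_cases) (auto simp: norm_minus_commute)
          next
            show "c * real N powr (- 1 / d) \<le> norm (y - a j)" if "j \<in> {1..N}" for j
              using far[OF that] \<eta>(1) by (simp add: q_def)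
          qed (use N y S aA r in auto)
          have fpos: "0 < norm (y - a j)" if "j \<in> {1..N}" for j using far[OF that] \<eta>(2) by linarith
          have "ennreal (b * real N powr (s / d)) \<le> (\<Sum>j=1..N. riesz_kernel s y (a j))"
            using N by (intro pot a big y) auto
          also have "\<dots> = ennreal (\<Sum>j=1..N. norm (y - a j) powr (- s))"
            using fpos by (intro sum_riesz_kernel) force+
          finally have "b * real N powr (s / d) \<le> (\<Sum>j=1..N. norm (y - a j) powr (- s))"
            by (simp add: sum_nonneg)
          \<comment> \<open>All distances are at least \<eta>, so the part s - s' of the exponent is
            bounded through \<eta>; the remaining exponent s' is summed by counting.\<close>
          also have "\<dots> \<le> (\<Sum>j=1..N. \<eta> powr (- (s - s')) * norm (y - a j) powr (- s'))"
          proof (rule sum_mono)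
            fix j assume j: "j \<in> {1..N}"
            have "norm (y - a j) powr (- s) = norm (y - a j) powr (- (s - s')) * norm (y - a j) powr (- s')"
              by (simp flip: powr_add)
            also have "\<dots> \<le> \<eta> powr (- (s - s')) * norm (y - a j) powr (- s')"
              using far[OF j] \<eta>(2) s' by (intro mult_right_mono powr_mono2') auto
            finally show "norm (y - a j) powr (- s) \<le> \<eta> powr (- (s - s')) * norm (y - a j) powr (- s')" .
          qed
          also have "\<dots> = \<eta> powr (- (s - s')) * (\<Sum>j=1..N. norm (y - a j) powr (- s'))"
            by (simp add: sum_distrib_left)
          also have "\<dots> \<le> \<eta> powr (- (s - s')) * ((L * real N) powr (s' / d) * Z)"
            unfolding Z_def using d s' fpos cnt
            by (intro mult_left_mono sum_powr_le_of_counting_suminf) auto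
          also have "\<dots> = L powr (s' / d) * Z * (\<eta> powr (- (s - s')) * real N powr (s' / d))"
            using L by (simp add: powr_mult)
          finally have "b * real N powr (s / d) \<le> L powr (s' / d) * Z * (\<eta> powr (- (s - s')) * real N powr (s' / d))" .
          \<comment> \<open>Multiplying by \<eta>^(s-s') and later by N^(-s/d) isolates
            \<eta>^(s-s'); the root of order s - s' then gives \<eta> \<le> c2 q.\<close>
          then have "\<eta> powr (s - s') * (b * real N powr (s / d)) \<le>
              \<eta> powr (s - s') * (L powr (s' / d) * Z * (\<eta> powr (- (s - s')) * real N powr (s' / d)))"
            by (intro mult_left_mono) auto
          also have "\<dots> = (\<eta> powr (s - s') * \<eta> powr (- (s - s'))) * (L powr (s' / d) * Z * real N powr (s' / d))"
            by (simp only: mult_ac)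
          also have "\<eta> powr (s - s') * \<eta> powr (- (s - s')) = 1"
            using \<eta>(2) by (simp flip: powr_add)
          finally have "\<eta> powr (s - s') * real N powr (s / d) \<le> L powr (s' / d) * Z / b * real N powr (s' / d)"
            using b by (simp add: field_simps)
          then have "\<eta> powr (s - s') * real N powr (s / d) * real N powr (- (s / d))
              \<le> L powr (s' / d) * Z / b * real N powr (s' / d) * real N powr (- (s / d))"
            by (intro mult_right_mono) auto
          also have "\<eta> powr (s - s') * real N powr (s / d) * real N powr (- (s / d)) = \<eta> powr (s - s')"
            using N by (simp add: mult.assoc flip: powr_add)
          also have "L powr (s' / d) * Z / b * real N powr (s' / d) * real N powr (- (s / d))
              = L powr (s' / d) * Z / b * real N powr (- (s - s') / d)"
            by (simp add: mult.assoc diff_divide_distrib flip: powr_add)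
          finally have "(\<eta> powr (s - s')) powr (1 / (s - s'))
              \<le> (L powr (s' / d) * Z / b * real N powr (- (s - s') / d)) powr (1 / (s - s'))"
            using s' by (intro powr_mono2) auto
          also have "\<dots> = c2 * (real N powr (- (s - s') / d)) powr (1 / (s - s'))"
            unfolding c2_def using L Z b by (subst powr_mult) auto
          also have "(real N powr (- (s - s') / d)) powr (1 / (s - s')) = q"
          proof -
            have "- t / d * (1 / t) = - 1 / d" if "t \<noteq> 0" for t :: real using that by simp
            from this[of "s - s'"] show ?thesis using s' by (simp only: q_def powr_powr)
          qed
          also have "(\<eta> powr (s - s')) powr (1 / (s - s')) = \<eta>"
            using \<eta>(2) s' by (simp add: powr_powr)
          finally show False using * by simp
        qed
        moreover have "0 \<le> c * q" "0 \<le> c2 * q" "0 \<le> c3 * q" using c c2 c3 q by auto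
        ultimately have "\<eta> \<le> c * q + c2 * q + c3 * q" by linarith
        then show ?thesis by (simp add: \<eta>_def X_def q_def distrib_right)
    qed
    moreover have "0 < c + c2 + c3" using c c2 c3 by linarith
    ultimately show ?thesis by blast
    qed
  qed
qed

end
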